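(* Let $N\ge 2$ and $$\underline{\mathbf A}=\mathbf A^{(1)}\times^1\underline{\mathbf A}^{(2)}\times^1\cdots\times^1\underline{\mathbf A}^{(N-1)}\times^1\mathbf A^{(N)}\in\mathbb R^{I_1\times I_2\times\cdots\times I_N},$$ $$\underline{\mathbf B}=\mathbf B^{(1)}\times^1\underline{\mathbf B}^{(2)}\times^1\cdots\times^1\underline{\mathbf B}^{(N-1)}\times^1\mathbf B^{(N)}\in\mathbb R^{J_1\times J_2\times\cdots\times J_N},$$ where $\mathbf A^{(1)}\in\mathbb R^{I_1\times R_1}$, $\underline{\mathbf A}^{(n)}\in\mathbb R^{R_{n-1}\times I_n\times R_n}$ for $n=2,\ldots,N-1$, $\mathbf A^{(N)}\in\mathbb R^{R_{N-1}\times I_N}$, and $\mathbf B^{(1)}\in\mathbb R^{J_1\times S_1}$, $\underline{\mathbf B}^{(n)}\in\mathbb R^{S_{n-1}\times J_n\times S_n}$ for $n=2,\ldots,N-1$, $\mathbf B^{(N)}\in\mathbb R^{S_{N-1}\times J_N}$. Then: (a) if $\underline{\mathbf A}$ and $\underline{\mathbf B}$ have the same size, $\underline{\mathbf A}+\underline{\mathbf B}=(\mathbf A^{(1)}\boxplus\mathbf B^{(1)})\times^1(\underline{\mathbf A}^{(2)}\boxplus\underline{\mathbf B}^{(2)})\times^1\cdots\times^1(\mathbf A^{(N)}\boxplus\mathbf B^{(N)})$; (b) $\underline{\mathbf A}\oplus\underline{\mathbf B}=(\mathbf A^{(1)}\oplus\mathbf B^{(1)})\times^1(\underline{\mathbf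 A}^{(2)}\oplus\underline{\mathbf B}^{(2)})\times^1\cdots\times^1(\mathbf A^{(N)}\oplus\mathbf B^{(N)})$; (c) if $\underline{\mathbf A}$ and $\underline{\mathbf B}$ have the same size, $\underline{\mathbf A}\circledast\underline{\mathbf B}=(\mathbf A^{(1)}\boxtimes\mathbf B^{(1)})\times^1(\underline{\mathbf A}^{(2)}\boxtimes\underline{\mathbf B}^{(2)})\times^1\cdots\times^1(\mathbf A^{(N)}\boxtimes\mathbf B^{(N)})$; (d) $\underline{\mathbf A}\otimes\underline{\mathbf B}=(\mathbf A^{(1)}\otimes\mathbf B^{(1)})\times^1(\underline{\mathbf A}^{(2)}\otimes\underline{\mathbf B}^{(2)})\times^1\cdots\times^1(\mathbf A^{(N)}\otimes\mathbf B^{(N)})$.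
   Context: Tensors are real arrays. Multi-index: $\overline{i_1i_2\cdots i_N}=i_N+(i_{N-1}-1)I_N+\cdots+(i_1-1)I_2I_3\cdots I_N$; in particular $\overline{ij}=j+(i-1)J$ for $i\le I$, $j\le J$. Contracted product: for $\underline{\mathbf X}\in\mathbb R^{I_1\times\cdots\times I_M}$ and $\underline{\mathbf Y}\in\mathbb R^{J_1\times\cdots\times J_N}$ with $I_M=J_1$, $\underline{\mathbf X}\times^1\underline{\mathbf Y}\in\mathbb R^{I_1\times\cdots\times I_{M-1}\times J_2\times\cdots\times J_N}$ has entries $\sum_{i_M}\underline{\mathbf X}(i_1,\ldots,i_M)\underline{\mathbf Y}(i_M,j_2,\ldots,j_N)$ (the iterated products above are associative). Kronecker product of same-order tensors: $(\underline{\mathbf X}\otimes\underline{\mathbf Y})(\overline{i_1j_1},\ldots,\overline{i_Nj_N})=\underline{\mathbf X}(i_1,\ldots,i_N)\underline{\mathbf Y}(j_1,\ldots,j_N)$. Hadamard product $\circledast$: entrywise product. Direct sum of same-order tensors of sizes $I_1\times\cdots\times I_N$, $J_1\times\cdots\times J_N$: the tensor of size $(I_1+J_1)\times\cdots\times(I_N+J_N)$ whose entry at $(k_1,\ldots,k_N)$ is $\underline{\mathbf X}(k_1,\ldots,k_N)$ if $k_n\le I_n$ for all $n$, $\underline{\mathbf Y}(k_1-I_1,\ldots,k_N-I_N)$ if $k_n>I_n$ for all $n$, and $0$ otherwise. Partial operations: the modes of the factor tensors with sizes denoted by $R$ or $S$ are auxiliary modes and those with sizes denoted by $I$ or $J$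 are physical modes. When the physical mode sizes agree, the partial Kronecker product $\boxtimes$ (resp. partial direct sum $\boxplus$) keeps the physical modes and, for each fixed value of the physical index, the subtensor in the auxiliary modes is the Kronecker product (resp. direct sum) of the corresponding subtensors. Explicitly, for $2\le n\le N-1$, $(\underline{\mathbf A}^{(n)}\boxtimes\underline{\mathbf B}^{(n)})(:,i_n,:)=\underline{\mathbf A}^{(n)}(:,i_n,:)\otimes\underline{\mathbf B}^{(n)}(:,i_n,:)$ and $(\underline{\mathbf A}^{(n)}\boxplus\underline{\mathbf B}^{(n)})(:,i_n,:)=\underline{\mathbf A}^{(n)}(:,i_n,:)\oplus\underline{\mathbf B}^{(n)}(:,i_n,:)$ (block diagonal matrix); for $n=1$ the rows $\mathbf A^{(1)}(i_1,:)$, $\mathbf B^{(1)}(i_1,:)$, and for $n=N$ the columns $\mathbf A^{(N)}(:,i_N)$, $\mathbf B^{(N)}(:,i_N)$, are combined as vectors (Kronecker product of vectors for $\boxtimes$, concatenation for $\boxplus$). *)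

theory Defs
  imports Complex_Main
begin

section \<open>Real tensors\<close>

text \<open>
  A tensor carries its list of mode sizes and its entries. Modes and indices are counted from 0,
  so mode \<open>k\<close> has the indices \<open>0, \<dots>, dims X ! k - 1\<close>. Entries at invalid multi-indices are fixed
  to 0, so that equality of tensors means equal sizes and equal entries.
\<close>

definition valid_index :: "nat list \<Rightarrow> nat list \<Rightarrow> bool" where
  "valid_index ds is \<longleftrightarrow> list_all2 (<) is ds"

typedef tensor = "{(ds, f :: nat list \<Rightarrow> real). \<forall>is. \<not> valid_index ds is \<longrightarrow> f is = 0}"
  by (rule exI[of _ "([], \<lambda>_. 0)"]) simp

definition dims :: "tensor \<Rightarrow> nat list" where
  "dims X = fst (Rep_tensor X)"

definition entry :: "tensor \<Rightarrow> nat list \<Rightarrow> real" where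
  "entry X = snd (Rep_tensor X)"

definition mk_tensor :: "nat list \<Rightarrow> (nat list \<Rightarrow> real) \<Rightarrow> tensor" where
  "mk_tensor ds f = Abs_tensor (ds, \<lambda>is. if valid_index ds is then f is else 0)"

abbreviation order :: "tensor \<Rightarrow> nat" where
  "order X \<equiv> length (dims X)"

lemma dims_mk_tensor [simp]: "dims (mk_tensor ds f) = ds"
  by (simp add: dims_def mk_tensor_def Abs_tensor_inverse)

lemma entry_mk_tensor:
  "entry (mk_tensor ds f) is = (if valid_index ds is then f is else 0)"
  by (simp add: entry_def mk_tensor_def Abs_tensor_inverse)

lemma entry_invalid: "\<not> valid_index (dims X) is \<Longrightarrow> entry X is = 0"
  using Rep_tensor[of X] by (auto simp: dims_def entry_def)

lemma tensor_eqI: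
  assumes "dims X = dims Y"
    and "\<And>is. valid_index (dims X) is \<Longrightarrow> entry X is = entry Y is"
  shows "X = Y"
proof -
  have "entry X is = entry Y is" for "is"
    using assms entry_invalid[of X "is"] entry_invalid[of Y "is"]
    by (cases "valid_index (dims X) is") auto
  hence "Rep_tensor X = Rep_tensor Y"
    using assms(1) by (simp add: prod_eq_iff dims_def entry_def fun_eq_iff)
  thus ?thesis by (simp add: Rep_tensor_inject)
qed

section \<open>Operations\<close>

text \<open>
  The operations are total; they have their usual meaning for tensors of the same size
  (sum, Hadamard product) or of the same order (Kronecker product, direct sum), and for the
  contracted product if the last mode of \<open>X\<close> and the first mode of \<open>Y\<close> have the same size.
\<close>

instantiation tensor :: plus
begin

definition plus_tensor :: "tensor \<Rightarrow> tensor \<Rightarrow> tensor" where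
  "X + Y = mk_tensor (dims X) (\<lambda>is. entry X is + entry Y is)"

instance ..

end

definition hadamard :: "tensor \<Rightarrow> tensor \<Rightarrow> tensor" (infixl "\<odot>" 70) where
  "X \<odot> Y = mk_tensor (dims X) (\<lambda>is. entry X is * entry Y is)"

definition contract :: "tensor \<Rightarrow> tensor \<Rightarrow> tensor" (infixl "\<times>\<^sup>1" 70) where
  "X \<times>\<^sup>1 Y = mk_tensor (butlast (dims X) @ tl (dims Y))
     (\<lambda>is. \<Sum>r<last (dims X).
        entry X (take (order X - 1) is @ [r]) * entry Y (r # drop (order X - 1) is))"

text \<open>
  The pair index of \<open>i\<close> and \<open>j\<close>, where \<open>j\<close> runs over a mode of size \<open>J\<close>. This is
  \<open>j + (i - 1) * J\<close> for indices counted from 1; its inverse is given by quotient and remainder.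
\<close>

definition pair_index :: "nat \<Rightarrow> nat \<Rightarrow> nat \<Rightarrow> nat" where
  "pair_index J i j = j + i * J"

definition kron :: "tensor \<Rightarrow> tensor \<Rightarrow> tensor" (infixl "\<otimes>" 70) where
  "X \<otimes> Y = mk_tensor (map2 (*) (dims X) (dims Y))
     (\<lambda>ks. entry X (map2 (div) ks (dims Y)) * entry Y (map2 (mod) ks (dims Y)))"

lemma entry_kron:
  assumes "order X = order Y"
    and "valid_index (dims X) is" and "valid_index (dims Y) js"
  defines "ks \<equiv> map (\<lambda>n. pair_index (dims Y ! n) (is ! n) (js ! n)) [0..<order X]"
  shows "valid_index (dims (X \<otimes> Y)) ks"
    and "entry (X \<otimes> Y) ks = entry X is * entry Y js"
proof -
  have len: "length is = order X" "length js = order X" "length ks = order X"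
    using assms by (auto simp: valid_index_def list_all2_lengthD)
  have lt: "is ! n < dims X ! n" "js ! n < dims Y ! n" if "n < order X" for n
    using assms(1-3) that by (auto simp: valid_index_def list_all2_conv_all_nth)
  have "pair_index (dims Y ! n) (is ! n) (js ! n) < dims X ! n * dims Y ! n"
    if "n < order X" for n
  proof -
    have "pair_index (dims Y ! n) (is ! n) (js ! n) < Suc (is ! n) * dims Y ! n"
      using lt[OF that] by (simp add: pair_index_def)
    also have "\<dots> \<le> dims X ! n * dims Y ! n"
      using lt[OF that] by (intro mult_right_mono) auto
    finally show ?thesis .
  qed
  then show valid: "valid_index (dims (X \<otimes> Y)) ks"
    using assms(1) by (simp add: kron_def valid_index_def list_all2_conv_all_nth ks_def)
  have "map2 (div) ks (dims Y) = is"
  proof (rule nth_equalityI)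
    fix n assume "n < length (map2 (div) ks (dims Y))"
    hence n: "n < order X" using len by simp
    show "map2 (div) ks (dims Y) ! n = is ! n"
      using n lt[OF n] len assms(1) by (simp add: ks_def pair_index_def)
  qed (use len assms(1) in simp)
  moreover have "map2 (mod) ks (dims Y) = js"
  proof (rule nth_equalityI)
    fix n assume "n < length (map2 (mod) ks (dims Y))"
    hence n: "n < order X" using len by simp
    show "map2 (mod) ks (dims Y) ! n = js ! n"
      using n lt[OF n] len assms(1) by (simp add: ks_def pair_index_def)
  qed (use len assms(1) in simp)
  ultimately show "entry (X \<otimes> Y) ks = entry X is * entry Y js"
    using valid by (simp add: kron_def entry_mk_tensor)
qed

definition direct_sum :: "tensor \<Rightarrow> tensor \<Rightarrow> tensor" (infixl "\<oplus>" 65) where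
  "X \<oplus> Y = mk_tensor (map2 (+) (dims X) (dims Y))
     (\<lambda>ks. if list_all2 (<) ks (dims X) then entry X ks
           else if list_all2 (\<ge>) ks (dims X) then entry Y (map2 (-) ks (dims X))
           else 0)"

section \<open>Partial operations\<close>

text \<open>
  In every factor of a tensor train exactly one mode is physical; its position \<open>p\<close> is an explicit
  argument of the partial operations. The tensor \<open>subtensor p i X\<close> is \<open>X(:, \<dots>, i, \<dots>, :)\<close>, with
  the index of mode \<open>p\<close> fixed to \<open>i\<close> and mode \<open>p\<close> removed.
\<close>

definition insert_at :: "nat \<Rightarrow> 'a \<Rightarrow> 'a list \<Rightarrow> 'a list" where
  "insert_at p x xs = take p xs @ x # drop p xs"

definition remove_at :: "nat \<Rightarrow> 'a list \<Rightarrow> 'a list" where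
  "remove_at p xs = take p xs @ drop (Suc p) xs"

definition subtensor :: "nat \<Rightarrow> nat \<Rightarrow> tensor \<Rightarrow> tensor" where
  "subtensor p i X = mk_tensor (remove_at p (dims X)) (\<lambda>js. entry X (insert_at p i js))"

lemma dims_subtensor: "dims (subtensor p i X) = remove_at p (dims X)"
  by (simp add: subtensor_def)

lemma entry_subtensor:
  "valid_index (remove_at p (dims X)) js \<Longrightarrow> entry (subtensor p i X) js = entry X (insert_at p i js)"
  by (simp add: subtensor_def entry_mk_tensor)

text \<open>
  The sizes of the auxiliary modes of the result are read off from the subtensors at index 0;
  \<open>subtensor\<close> has the same size for every index, and so do the results of \<open>\<otimes>\<close> and \<open>\<oplus>\<close>.
\<close>

definition partial_op :: "(tensor \<Rightarrow> tensor \<Rightarrow> tensor) \<Rightarrow> nat \<Rightarrow> tensor \<Rightarrow> tensor \<Rightarrow> tensor" where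
  "partial_op f p X Y =
     mk_tensor (insert_at p (dims X ! p) (dims (f (subtensor p 0 X) (subtensor p 0 Y))))
       (\<lambda>is. entry (f (subtensor p (is ! p) X) (subtensor p (is ! p) Y)) (remove_at p is))"

definition partial_kron :: "nat \<Rightarrow> tensor \<Rightarrow> tensor \<Rightarrow> tensor" where
  "partial_kron = partial_op (\<otimes>)"

definition partial_direct_sum :: "nat \<Rightarrow> tensor \<Rightarrow> tensor \<Rightarrow> tensor" where
  "partial_direct_sum = partial_op (\<oplus>)"

lemma subtensor_partial_op:
  assumes dims_f: "\<And>X Y. dims (f X Y) = map2 g (dims X) (dims Y)"
    and "order X = order Y" and p: "p < order X" and i: "i < dims X ! p"
  shows "subtensor p i (partial_op f p X Y) = f (subtensor p i X) (subtensor p i Y)"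
proof -
  let ?ds = "map2 g (remove_at p (dims X)) (remove_at p (dims Y))"
  have ds: "dims (f (subtensor p j X) (subtensor p j Y)) = ?ds" for j
    by (simp add: dims_f dims_subtensor)
  have len: "p \<le> length ?ds"
    using assms(2) p by (simp add: remove_at_def)
  have rem: "remove_at p (insert_at p x xs) = xs" if "p \<le> length xs" for x :: nat and xs
    using that by (simp add: remove_at_def insert_at_def min_absorb2)
  have at: "insert_at p x xs ! p = x" if "p \<le> length xs" for x :: nat and xs
    using that by (simp add: insert_at_def nth_append)
  have dims_eq: "dims (subtensor p i (partial_op f p X Y)) = ?ds"
    using rem[OF len] by (simp add: dims_subtensor partial_op_def ds)
  show ?thesis
  proof (rule tensor_eqI)
    fix js assume "valid_index (dims (subtensor p i (partial_op f p X Y))) js"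
    hence v: "list_all2 (<) js ?ds" by (simp only: dims_eq valid_index_def)
    hence lj: "p \<le> length js" using len by (simp only: list_all2_lengthD)
    have "list_all2 (<) (insert_at p i js) (insert_at p (dims X ! p) ?ds)"
      using v i unfolding insert_at_def
      by (intro list_all2_appendI list.rel_intros list_all2_takeI list_all2_dropI) auto
    thus "entry (subtensor p i (partial_op f p X Y)) js =
        entry (f (subtensor p i X) (subtensor p i Y)) js"
      using v rem[OF len] rem[OF lj] at[OF lj]
      by (simp add: entry_subtensor partial_op_def entry_mk_tensor ds valid_index_def)
  qed (simp add: dims_eq ds)
qed

lemma subtensor_partial_kron:
  assumes "order X = order Y" "p < order X" "i < dims X ! p"
  shows "subtensor p i (partial_kron p X Y) = subtensor p i X \<otimes> subtensor p i Y"
  unfolding partial_kron_def using assms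
  by (intro subtensor_partial_op[where g = "(*)"]) (simp_all add: kron_def)

lemma subtensor_partial_direct_sum:
  assumes "order X = order Y" "p < order X" "i < dims X ! p"
  shows "subtensor p i (partial_direct_sum p X Y) = subtensor p i X \<oplus> subtensor p i Y"
  unfolding partial_direct_sum_def using assms
  by (intro subtensor_partial_op[where g = "(+)"]) (simp_all add: direct_sum_def)

section \<open>Tensor trains\<close>

text \<open>
  The factors are numbered \<open>1, \<dots>, N\<close>. The physical mode is the first mode of factor 1 and the
  second mode of every other factor; all other modes are auxiliary.
\<close>

definition train_factors ::
  "nat \<Rightarrow> (nat \<Rightarrow> nat) \<Rightarrow> (nat \<Rightarrow> nat) \<Rightarrow> (nat \<Rightarrow> tensor) \<Rightarrow> bool" where
  "train_factors N I R A \<longleftrightarrow>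
     dims (A 1) = [I 1, R 1] \<and>
     (\<forall>n\<in>{2..N-1}. dims (A n) = [R (n-1), I n, R n]) \<and>
     dims (A N) = [R (N-1), I N]"

definition physical_mode :: "nat \<Rightarrow> nat" where
  "physical_mode n = (if n = 1 then 0 else 1)"

definition train :: "nat \<Rightarrow> (nat \<Rightarrow> tensor) \<Rightarrow> tensor" where
  "train N A = foldl (\<times>\<^sup>1) (A 1) (map A [2..<N+1])"

lemma dims_train:
  assumes "N \<ge> 2" "train_factors N I R A"
  shows "dims (train N A) = map I [1..<N+1]"
proof -
  have "dims (foldl (\<times>\<^sup>1) (A 1) (map A [2..<Suc n])) = map I [1..<Suc n] @ [R n]"
    if "1 \<le> n" "n < N" for n
    using that
  proof (induction n rule: dec_induct)
    case base
    then show ?case using assms by (simp add: train_factors_def)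
  next
    case (step n)
    have "[2..<Suc (Suc n)] = [2..<Suc n] @ [Suc n]"
      using step by simp
    moreover have "dims (A (Suc n)) = [R n, I (Suc n), R (Suc n)]"
      using assms step unfolding train_factors_def by auto
    ultimately show ?case using step by (simp add: contract_def del: upt_Suc)
        (simp add: butlast_append)
  qed
  from this[of "N - 1"] have "dims (foldl (\<times>\<^sup>1) (A 1) (map A [2..<N])) = map I [1..<N] @ [R (N-1)]"
    using assms(1) by (simp del: upt_Suc)
  moreover have "[2..<N+1] = [2..<N] @ [N]" "[1..<N+1] = [1..<N] @ [N]" using assms(1) by auto
  ultimately show ?thesis
    using assms by (simp add: train_def train_factors_def contract_def butlast_append del: upt_Suc)
qed

end

theory Submission
  imports Defs
begin

text \<open>
  Fixing the physical indices turns every factor of a train into a matrix (a row vector for the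
  first and a column vector for the last factor), and the entry of the train is the product of
  these matrices. The slices of the factors on the right-hand sides are block diagonal matrices
  in (a) and (b) and Kronecker products of matrices in (c) and (d), so all four identities reduce
  to multiplying block diagonal matrices and to the mixed product rule. In (b), moreover, a block
  of a slice vanishes unless the physical index lies in the range of the corresponding factor,
  which makes the product vanish at all mixed multi-indices.
\<close>

section \<open>Contracted products\<close>

lemma dims_contract:
  "dims X = ds @ [R] \<Longrightarrow> dims Y = R # es \<Longrightarrow> dims (X \<times>\<^sup>1 Y) = ds @ es"
  by (simp add: contract_def)

text \<open>\<open>contract\<close> cuts the multi-index after its first \<open>order X - 1\<close>
  entries. In the form \<open>is @ js\<close>, with \<open>is\<close> valid for \<open>ds\<close>,
  it is cut exactly between the two parts.\<close>

lemma entry_contract: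
  assumes "dims X = ds @ [R]" "dims Y = R # es" "valid_index ds is" "valid_index es js"
  shows "entry (X \<times>\<^sup>1 Y) (is @ js) = (\<Sum>r<R. entry X (is @ [r]) * entry Y (r # js))"
proof -
  have "length is = length ds"
    using assms(3) by (simp add: valid_index_def list_all2_lengthD)
  thus ?thesis
    using assms by (simp add: contract_def entry_mk_tensor valid_index_def list_all2_appendI)
qed

section \<open>Row vectors propagated through matrices\<close>

text \<open>
  The row vector obtained by multiplying the matrices \<open>G 1, \<dots>, G (n + 1)\<close>, where \<open>G 1\<close> is a row
  (its row index is 0) and \<open>G k\<close> has \<open>R (k - 1)\<close> rows.
\<close>

primrec chain :: "(nat \<Rightarrow> nat) \<Rightarrow> (nat \<Rightarrow> nat \<Rightarrow> nat \<Rightarrow> real) \<Rightarrow> nat \<Rightarrow> nat \<Rightarrow> real" where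
  "chain R G 0 c = G 1 0 c"
| "chain R G (Suc n) c = (\<Sum>r<R (Suc n). chain R G n r * G (Suc (Suc n)) r c)"

text \<open>At factor \<open>k\<close> every summand contains an entry of \<open>G k\<close>; beyond
  it every summand contains a shorter chain that is already zero. In a direct sum this annihilates
  the products at mixed multi-indices.\<close>

lemma chain_eq_0:
  assumes "1 \<le> k" "k \<le> Suc n" "\<And>r c. G k r c = 0"
  shows "chain R G n c = 0"
  using assms(2)
proof (induction n arbitrary: c)
  case 0
  with assms(1) have "k = 1" by simp
  with assms(3) show ?case by simp
next
  case (Suc n)
  then show ?case using assms(3) by (cases "k = Suc (Suc n)") auto
qed

lemma chain_cong:
  assumes "\<And>k r c. 1 \<le> k \<Longrightarrow> k \<le> Suc n \<Longrightarrow> G k r c = H k r c"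
  shows "chain R G n c = chain R H n c"
  using assms by (induction n arbitrary: c) auto

section \<open>Block diagonal matrices\<close>

lemma sum_lessThan_add:
  fixes f :: "nat \<Rightarrow> 'a::comm_monoid_add"
  shows "(\<Sum>r<m + n. f r) = (\<Sum>r<m. f r) + (\<Sum>r<n. f (m + r))"
proof -
  have "(\<Sum>r<m + n. f r) = (\<Sum>r<m. f r) + (\<Sum>r=m..<m + n. f r)"
    by (simp add: lessThan_atLeast0 sum.atLeastLessThan_concat)
  also have "(\<Sum>r=m..<m + n. f r) = (\<Sum>r<n. f (m + r))"
    using sum.shift_bounds_nat_ivl[of f 0 m n] by (simp add: lessThan_atLeast0 add.commute)
  finally show ?thesis .
qed

text \<open>The row vector stays a concatenation of two independent row vectors, because a block
  diagonal factor acts on each half alone. The first factor provides the concatenation; the last one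
  stacks two columns, so the final contraction adds the two products.\<close>

lemma chain_block:
  assumes first: "\<And>c. c < R 1 \<Longrightarrow> G 1 0 c = U 1 0 c"
      "\<And>c. c < S 1 \<Longrightarrow> G 1 0 (R 1 + c) = V 1 0 c"
    and mid: "\<And>k r c. 2 \<le> k \<Longrightarrow> k \<le> Suc n \<Longrightarrow> r < R (k - 1) \<Longrightarrow> c < R k \<Longrightarrow> G k r c = U k r c"
      "\<And>k r c. 2 \<le> k \<Longrightarrow> k \<le> Suc n \<Longrightarrow> r < S (k - 1) \<Longrightarrow> c < S k \<Longrightarrow>
        G k (R (k - 1) + r) (R k + c) = V k r c"
      "\<And>k r c. 2 \<le> k \<Longrightarrow> k \<le> Suc n \<Longrightarrow> r < R (k - 1) \<Longrightarrow> c < S k \<Longrightarrow> G k r (R k + c) = 0"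
      "\<And>k r c. 2 \<le> k \<Longrightarrow> k \<le> Suc n \<Longrightarrow> r < S (k - 1) \<Longrightarrow> c < R k \<Longrightarrow> G k (R (k - 1) + r) c = 0"
    and last: "\<And>r. r < R (Suc n) \<Longrightarrow> G (Suc (Suc n)) r 0 = U (Suc (Suc n)) r 0"
      "\<And>r. r < S (Suc n) \<Longrightarrow> G (Suc (Suc n)) (R (Suc n) + r) 0 = V (Suc (Suc n)) r 0"
  shows "chain (\<lambda>k. R k + S k) G (Suc n) 0 = chain R U (Suc n) 0 + chain S V (Suc n) 0"
proof -
  \<comment> \<open>Invariant for the product of the first \<open>m + 1\<close> factors. The bound
    \<open>m \<le> n\<close> leaves out the last factor, which is stacked rather than block
    diagonal.\<close>
  have "(\<forall>c<R (Suc m). chain (\<lambda>k. R k + S k) G m c = chain R U m c) \<and>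
        (\<forall>c<S (Suc m). chain (\<lambda>k. R k + S k) G m (R (Suc m) + c) = chain S V m c)"
    if "m \<le> n" for m
    using that
  proof (induction m)
    case 0
    show ?case using first by simp
  next
    case (Suc m)
    then show ?case
      using mid[of "Suc (Suc m)"] by (simp add: sum_lessThan_add)
  qed
  from this[of n] show ?thesis
    using last by (simp add: sum_lessThan_add)
qed

section \<open>Kronecker products and the mixed product rule\<close>

lemma sum_div_mod:
  fixes f g :: "nat \<Rightarrow> 'a::comm_semiring_0"
  shows "(\<Sum>r<m * n. f (r div n) * g (r mod n)) = (\<Sum>r<m. f r) * (\<Sum>r<n. g r)"
proof -
  \<comment> \<open>The range is cut into \<open>m\<close> intervals of length \<open>n\<close>; on
    the interval of \<open>q\<close>, the quotient is constantly \<open>q\<close> and the remainder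
    takes each value below \<open>n\<close> once.\<close>
  have "(\<Sum>r<m * n. f (r div n) * g (r mod n)) =
      (\<Sum>q<m. \<Sum>r=q * n..<q * n + n. f (r div n) * g (r mod n))"
    by (rule sum.nat_group[symmetric])
  also have "\<dots> = (\<Sum>q<m. \<Sum>r<n. f q * g r)"
  proof (rule sum.cong[OF refl])
    fix q
    have "(\<Sum>r=q * n..<q * n + n. f (r div n) * g (r mod n)) =
        (\<Sum>r<n. f ((r + q * n) div n) * g ((r + q * n) mod n))"
      using sum.shift_bounds_nat_ivl[of "\<lambda>r. f (r div n) * g (r mod n)" 0 "q * n" n]
      by (simp add: lessThan_atLeast0 add.commute)
    also have "\<dots> = (\<Sum>r<n. f q * g r)"
      by (rule sum.cong) auto
    finally show "(\<Sum>r=q * n..<q * n + n. f (r div n) * g (r mod n)) = (\<Sum>r<n. f q * g r)" .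
  qed
  finally show ?thesis by (simp add: sum_product)
qed

text \<open>Mixed product rule: a Kronecker product of row vectors times a Kronecker product of
  matrices is the Kronecker product of the two products. Quotient and remainder by the second size
  undo the pairing of indices.\<close>

lemma chain_kron:
  assumes first: "\<And>c. c < R 1 * S 1 \<Longrightarrow> G 1 0 c = U 1 0 (c div S 1) * V 1 0 (c mod S 1)"
    and mid: "\<And>k r c. 2 \<le> k \<Longrightarrow> k \<le> Suc n \<Longrightarrow> r < R (k - 1) * S (k - 1) \<Longrightarrow> c < R k * S k \<Longrightarrow>
      G k r c = U k (r div S (k - 1)) (c div S k) * V k (r mod S (k - 1)) (c mod S k)"
    and last: "\<And>r. r < R (Suc n) * S (Suc n) \<Longrightarrow> G (Suc (Suc n)) r 0 =
      U (Suc (Suc n)) (r div S (Suc n)) 0 * V (Suc (Suc n)) (r mod S (Suc n)) 0"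
  shows "chain (\<lambda>k. R k * S k) G (Suc n) 0 = chain R U (Suc n) 0 * chain S V (Suc n) 0"
proof -
  \<comment> \<open>The target columns \<open>a\<close> and \<open>b\<close> stay free: they are
    quotient and remainder of \<open>c\<close> at a middle factor and both 0 at the last
    one.\<close>
  have step: "(\<Sum>r<R (Suc m) * S (Suc m). chain (\<lambda>k. R k * S k) G m r * G (Suc (Suc m)) r c) =
      chain R U (Suc m) a * chain S V (Suc m) b"
    if "\<forall>r<R (Suc m) * S (Suc m). chain (\<lambda>k. R k * S k) G m r =
        chain R U m (r div S (Suc m)) * chain S V m (r mod S (Suc m))"
      and "\<And>r. r < R (Suc m) * S (Suc m) \<Longrightarrow> G (Suc (Suc m)) r c =
        U (Suc (Suc m)) (r div S (Suc m)) a * V (Suc (Suc m)) (r mod S (Suc m)) b"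
    for m a b c
  proof -
    have "(\<Sum>r<R (Suc m) * S (Suc m). chain (\<lambda>k. R k * S k) G m r * G (Suc (Suc m)) r c) =
        (\<Sum>r<R (Suc m) * S (Suc m).
          (\<lambda>r. chain R U m r * U (Suc (Suc m)) r a) (r div S (Suc m)) *
          (\<lambda>r. chain S V m r * V (Suc (Suc m)) r b) (r mod S (Suc m)))"
      using that by (intro sum.cong) auto
    also have "\<dots> = chain R U (Suc m) a * chain S V (Suc m) b"
      by (subst sum_div_mod) simp
    finally show ?thesis .
  qed
  have "\<forall>c<R (Suc m) * S (Suc m). chain (\<lambda>k. R k * S k) G m c =
      chain R U m (c div S (Suc m)) * chain S V m (c mod S (Suc m))"
    if "m \<le> n" for m
    using that
  proof (induction m)
    case 0
    show ?case using first by simp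
  next
    case (Suc m)
    then show ?case
      \<comment> \<open>Only the chain over the paired sizes is unfolded, which gives the goal the
        shape of \<open>step\<close>.\<close>
      unfolding chain.simps(2)[of "\<lambda>k. R k * S k"]
      using mid[of "Suc (Suc m)"] by (intro allI impI step) auto
  qed
  from step[OF this[of n] last] show ?thesis by simp
qed

section \<open>Entries of trains as matrix products\<close>

text \<open>
  The matrix with entries \<open>A\<^sup>(\<^sup>n\<^sup>)(r, i, c)\<close>; the missing row of the first and the missing column
  of the last factor have index 0.
\<close>

definition slice :: "nat \<Rightarrow> (nat \<Rightarrow> tensor) \<Rightarrow> nat \<Rightarrow> nat \<Rightarrow> nat \<Rightarrow> nat \<Rightarrow> real" where
  "slice N A n i r c =
     entry (A n) (if n = 1 then [i, c] else if n = N then [r, i] else [r, i, c])"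

text \<open>A partial product has one open auxiliary mode. For fixed physical indices its entries
  along that mode form the row vector of \<open>chain\<close>, and each contraction multiplies it by
  the next slice. The last factor closes the open mode.\<close>

lemma entry_train:
  assumes "N \<ge> 2" "train_factors N I R A" "valid_index (map I [1..<N+1]) ks"
  shows "entry (train N A) ks = chain R (\<lambda>n. slice N A n (ks ! (n - 1))) (N - 1) 0"
proof -
  \<comment> \<open>\<open>?P n\<close> contracts the factors 1 to \<open>n + 1\<close>, as many as
    \<open>chain R ?G n\<close> multiplies. Factor \<open>k\<close> takes its physical index from
    list position \<open>k - 1\<close>.\<close>
  let ?P = "\<lambda>n. foldl (\<times>\<^sup>1) (A 1) (map A [2..<n+2])"
  let ?G = "\<lambda>n. slice N A n (ks ! (n - 1))"
  have len: "length ks = N"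
    using assms(3) by (simp add: valid_index_def list_all2_lengthD del: upt_Suc)
  have lt: "ks ! n < I (Suc n)" if "n < N" for n
    using assms(3) that by (auto simp: valid_index_def list_all2_conv_all_nth simp del: upt_Suc)
  have valid: "valid_index (map I [1..<n+1]) (take n ks)" if "n \<le> N" for n
    using that len lt by (auto simp: valid_index_def list_all2_conv_all_nth simp del: upt_Suc)
  have P_Suc: "?P (Suc n) = ?P n \<times>\<^sup>1 A (n + 2)" for n
    by simp
  \<comment> \<open>Sizes and entries are proved together because \<open>entry_contract\<close>
    needs the sizes. The bound \<open>n + 1 < N\<close> ensures that factor \<open>n + 1\<close>
    still has an outgoing auxiliary mode.\<close>
  have prefix: "dims (?P n) = map I [1..<n+2] @ [R (n + 1)] \<and>
      (\<forall>c<R (n + 1). entry (?P n) (take (n + 1) ks @ [c]) = chain R ?G n c)"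
    if "n + 1 < N" for n
    using that
  proof (induction n)
    case 0
    then show ?case using assms(2) len
      by (simp add: train_factors_def slice_def take_Suc_conv_app_nth)
  next
    case (Suc n)
    have dA: "dims (A (n + 2)) = [R (n + 1), I (n + 2), R (n + 2)]"
      using assms(2) Suc.prems by (auto simp: train_factors_def)
    have IH: "dims (?P n) = map I [1..<n+2] @ [R (n + 1)]"
      "\<And>c. c < R (n + 1) \<Longrightarrow> entry (?P n) (take (n + 1) ks @ [c]) = chain R ?G n c"
      using Suc by auto
    have "entry (?P (Suc n)) (take (Suc n + 1) ks @ [c]) = chain R ?G (Suc n) c"
      if c: "c < R (Suc n + 1)" for c
    proof -
      have "valid_index [I (n + 2), R (n + 2)] [ks ! (n + 1), c]"
        using Suc.prems c lt[of "n + 1"] by (simp add: valid_index_def)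
      moreover have "take (Suc n + 1) ks @ [c] = take (n + 1) ks @ [ks ! (n + 1), c]"
        using Suc.prems len by (simp add: take_Suc_conv_app_nth)
      ultimately have "entry (?P (Suc n)) (take (Suc n + 1) ks @ [c]) =
          (\<Sum>r<R (n + 1). entry (?P n) (take (n + 1) ks @ [r]) * entry (A (n + 2)) [r, ks ! (n + 1), c])"
        using entry_contract[OF IH(1) dA, of "take (n + 1) ks" "[ks ! (n + 1), c]"]
          valid[of "n + 1"] Suc.prems unfolding P_Suc by simp
      also have "\<dots> = chain R ?G (Suc n) c"
        using IH(2) Suc.prems by (simp add: slice_def)
      finally show ?thesis .
    qed
    moreover have "dims (?P (Suc n)) = map I [1..<Suc n + 2] @ [R (Suc n + 1)]"
      unfolding P_Suc using dims_contract[OF IH(1) dA] by simp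
    ultimately show ?case by blast
  qed
  obtain m where N: "N = m + 2"
    using assms(1) by (metis add.commute le_Suc_ex)
  have dN: "dims (A (m + 2)) = [R (m + 1), I (m + 2)]"
    using assms(2) N by (simp add: train_factors_def)
  have ks: "ks = take (m + 1) ks @ [ks ! (m + 1)]"
    using len N by (metis Suc_eq_plus1 add_2_eq_Suc' lessI take_Suc_conv_app_nth take_all_iff le_refl)
  have "entry (train N A) ks = entry (?P m \<times>\<^sup>1 A (m + 2)) (take (m + 1) ks @ [ks ! (m + 1)])"
    using ks by (simp add: N train_def)
  also have "\<dots> =
      (\<Sum>r<R (m + 1). entry (?P m) (take (m + 1) ks @ [r]) * entry (A (m + 2)) [r, ks ! (m + 1)])"
    using prefix[of m] dN N valid[of "m + 1"] lt[of "m + 1"]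
    by (intro entry_contract[where es = "[I (m + 2)]" and ds = "map I [1..<m + 2]"])
       (simp_all add: valid_index_def del: upt_Suc)
  also have "\<dots> = chain R ?G (N - 1) 0"
    using prefix[of m] N by (simp add: slice_def)
  finally show ?thesis .
qed

section \<open>Slices of combined factors\<close>

lemmas operation_simps =
  partial_direct_sum_def partial_kron_def partial_op_def direct_sum_def kron_def subtensor_def
  insert_at_def remove_at_def physical_mode_def slice_def entry_mk_tensor valid_index_def

text \<open>The sizes as rewrite rules in simplifier normal form, with \<open>Suc 0\<close> for
  1.\<close>

lemma dims_factor:
  assumes "train_factors N I R A"
  shows "dims (A (Suc 0)) = [I (Suc 0), R (Suc 0)]"
    and "\<And>n. 2 \<le> n \<Longrightarrow> n < N \<Longrightarrow> dims (A n) = [R (n - Suc 0), I n, R n]"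
    and "dims (A N) = [R (N - Suc 0), I N]"
  using assms by (auto simp: train_factors_def)

text \<open>A physical index outside its mode makes every multi-index of the slice invalid, and
  entries there are 0 by convention.\<close>

lemma slice_eq_0:
  assumes "train_factors N I R A" "1 \<le> n" "n \<le> N" "I n \<le> i"
  shows "slice N A n i r c = 0"
proof -
  consider "n = 1" | "2 \<le> n" "n < N" | "n = N" "n \<noteq> 1"
    using assms(2,3) by linarith
  thus ?thesis
    using assms(4) dims_factor[OF assms(1)]
    by cases (auto simp: slice_def valid_index_def intro!: entry_invalid)
qed

context
  fixes N :: nat and I J R S :: "nat \<Rightarrow> nat" and A B :: "nat \<Rightarrow> tensor"
  assumes N: "N \<ge> 2" and A: "train_factors N I R A" and B: "train_factors N J S B"
begin

lemma train_factors_direct_sum: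
  "train_factors N (\<lambda>n. I n + J n) (\<lambda>n. R n + S n) (\<lambda>n. A n \<oplus> B n)"
  using A B by (simp add: train_factors_def direct_sum_def)

lemma train_factors_kron:
  "train_factors N (\<lambda>n. I n * J n) (\<lambda>n. R n * S n) (\<lambda>n. A n \<otimes> B n)"
  using A B by (simp add: train_factors_def kron_def)

lemma train_factors_partial_direct_sum:
  "train_factors N I (\<lambda>n. R n + S n)
    (\<lambda>n. partial_direct_sum (physical_mode n) (A n) (B n))"
  using A B N by (simp add: train_factors_def operation_simps)

lemma train_factors_partial_kron:
  "train_factors N I (\<lambda>n. R n * S n)
    (\<lambda>n. partial_kron (physical_mode n) (A n) (B n))"
  using A B N by (simp add: train_factors_def operation_simps)

lemma chain_partial_direct_sum:
  assumes "\<And>n. 1 \<le> n \<Longrightarrow> n \<le> N \<Longrightarrow> k n < I n"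
  shows "chain (\<lambda>n. R n + S n)
      (\<lambda>n. slice N (\<lambda>n. partial_direct_sum (physical_mode n) (A n) (B n)) n (k n)) (N - 1) 0 =
    chain R (\<lambda>n. slice N A n (k n)) (N - 1) 0 + chain S (\<lambda>n. slice N B n (k n)) (N - 1) 0"
proof -
  \<comment> \<open>This turns \<open>N - 1\<close> into \<open>Suc m\<close>, the chain argument in
    \<open>chain_block\<close>.\<close>
  obtain m where m: "N = Suc (Suc m)"
    using N by (metis add_2_eq_Suc le_Suc_ex)
  show ?thesis
    using dims_factor[OF A] dims_factor[OF B] assms unfolding m diff_Suc_1
    by (intro chain_block) (simp_all add: operation_simps)
qed

lemma chain_partial_kron:
  assumes "\<And>n. 1 \<le> n \<Longrightarrow> n \<le> N \<Longrightarrow> k n < I n"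
  shows "chain (\<lambda>n. R n * S n)
      (\<lambda>n. slice N (\<lambda>n. partial_kron (physical_mode n) (A n) (B n)) n (k n)) (N - 1) 0 =
    chain R (\<lambda>n. slice N A n (k n)) (N - 1) 0 * chain S (\<lambda>n. slice N B n (k n)) (N - 1) 0"
proof -
  obtain m where m: "N = Suc (Suc m)"
    using N by (metis add_2_eq_Suc le_Suc_ex)
  show ?thesis
    using dims_factor[OF A] dims_factor[OF B] assms unfolding m diff_Suc_1
    \<comment> \<open>\<open>subtensor\<close> guards its entries by validity of the quotient and
      remainder indices. Where the guard fails, \<open>entry_invalid\<close> makes the entry of the
      factor 0 too, so both sides agree.\<close>
    by (intro chain_kron) (auto simp: operation_simps entry_invalid)
qed

text \<open>In the first block the slice of \<open>A n\<close> vanishes by itself when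
  \<open>I n \<le> k n\<close>. The second block carries a guard because truncated subtraction would
  send every \<open>k n < I n\<close> to index 0 of \<open>B n\<close>.\<close>

lemma chain_direct_sum:
  assumes "\<And>n. 1 \<le> n \<Longrightarrow> n \<le> N \<Longrightarrow> k n < I n + J n"
  shows "chain (\<lambda>n. R n + S n) (\<lambda>n. slice N (\<lambda>n. A n \<oplus> B n) n (k n)) (N - 1) 0 =
    chain R (\<lambda>n. slice N A n (k n)) (N - 1) 0 +
    chain S (\<lambda>n r c. if I n \<le> k n then slice N B n (k n - I n) r c else 0) (N - 1) 0"
proof -
  obtain m where m: "N = Suc (Suc m)"
    using N by (metis add_2_eq_Suc le_Suc_ex)
  show ?thesis
    using dims_factor[OF A] dims_factor[OF B] assms unfolding m diff_Suc_1
    by (intro chain_block) (auto simp: operation_simps not_less entry_invalid)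
qed

lemma chain_kron_slices:
  assumes "\<And>n. 1 \<le> n \<Longrightarrow> n \<le> N \<Longrightarrow> k n < I n * J n"
  shows "chain (\<lambda>n. R n * S n) (\<lambda>n. slice N (\<lambda>n. A n \<otimes> B n) n (k n)) (N - 1) 0 =
    chain R (\<lambda>n. slice N A n (k n div J n)) (N - 1) 0 *
    chain S (\<lambda>n. slice N B n (k n mod J n)) (N - 1) 0"
proof -
  obtain m where m: "N = Suc (Suc m)"
    using N by (metis add_2_eq_Suc le_Suc_ex)
  show ?thesis
    using dims_factor[OF A] dims_factor[OF B] assms unfolding m diff_Suc_1
    by (intro chain_kron) (simp_all add: operation_simps)
qed

end

section \<open>The four identities, entry by entry\<close>

text \<open>Passes from list positions, counted from 0, to factor numbers, counted from 1, as the
  bounds in the chain lemmas require.\<close>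

lemma valid_index_map_upt:
  "valid_index (map I [1..<N+1]) ks \<longleftrightarrow>
    length ks = N \<and> (\<forall>n. 1 \<le> n \<longrightarrow> n \<le> N \<longrightarrow> ks ! (n - 1) < I n)"
proof -
  have "(\<forall>m<N. ks ! m < I (Suc m)) \<longleftrightarrow> (\<forall>n. 1 \<le> n \<longrightarrow> n \<le> N \<longrightarrow> ks ! (n - 1) < I n)"
    by (metis One_nat_def Suc_le_eq Suc_pred diff_Suc_1 le_simps(3) less_imp_le_nat zero_less_Suc)
  thus ?thesis
    by (auto simp: valid_index_def list_all2_conv_all_nth simp del: upt_Suc)
qed

lemma map2_map_upt:
  "length ks = N \<Longrightarrow> map2 f ks (map I [1..<N+1]) = map (\<lambda>n. f (ks ! (n - 1)) (I n)) [1..<N+1]"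
  by (rule nth_equalityI) (simp_all del: upt_Suc)

lemma nth_map_upt_1: "1 \<le> n \<Longrightarrow> n \<le> N \<Longrightarrow> map f [1..<N+1] ! (n - 1) = f n"
  by (simp del: upt_Suc)

theorem proposition2p4:
  fixes N :: nat and I J R S :: "nat \<Rightarrow> nat"
    and Afac Bfac :: "nat \<Rightarrow> tensor" and A B :: tensor
  assumes "N \<ge> 2"
    and "train_factors N I R Afac" and "A = train N Afac"
    and "train_factors N J S Bfac" and "B = train N Bfac"
  shows "(dims A = dims B \<longrightarrow>
            A + B = train N (\<lambda>n. partial_direct_sum (physical_mode n) (Afac n) (Bfac n)))
       \<and> A \<oplus> B = train N (\<lambda>n. Afac n \<oplus> Bfac n)
       \<and> (dims A = dims B \<longrightarrow>
            A \<odot> B = train N (\<lambda>n. partial_kron (physical_mode n) (Afac n) (Bfac n)))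
       \<and> A \<otimes> B = train N (\<lambda>n. Afac n \<otimes> Bfac n)"
proof (intro conjI impI)
  note N = assms(1) and Af = assms(2) and Bf = assms(4)
  note factors = N Af Bf
  have dA: "dims A = map I [1..<N+1]" and dB: "dims B = map J [1..<N+1]"
    using dims_train assms by blast+
  have eA: "entry A ks = chain R (\<lambda>n. slice N Afac n (ks ! (n - 1))) (N - 1) 0"
    if "valid_index (map I [1..<N+1]) ks" for ks
    using entry_train[OF N Af that] assms(3) by simp
  have eB: "entry B ks = chain S (\<lambda>n. slice N Bfac n (ks ! (n - 1))) (N - 1) 0"
    if "valid_index (map J [1..<N+1]) ks" for ks
    using entry_train[OF N Bf that] assms(5) by simp
  {
    assume eq: "dims A = dims B"
    let ?C = "\<lambda>n. partial_direct_sum (physical_mode n) (Afac n) (Bfac n)"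
    note C = train_factors_partial_direct_sum[OF factors]
    show "A + B = train N ?C"
    proof (rule tensor_eqI)
      show "dims (A + B) = dims (train N ?C)"
        using dims_train[OF N C] dA by (simp add: plus_tensor_def)
      fix ks assume "valid_index (dims (A + B)) ks"
      hence v: "valid_index (map I [1..<N+1]) ks" by (simp add: plus_tensor_def dA)
      \<comment> \<open>Equal sizes identify \<open>I\<close> and \<open>J\<close> only on 1 to
        \<open>N\<close>, so validity is transferred through the size lists.\<close>
      hence v': "valid_index (map J [1..<N+1]) ks" using eq dA dB by metis
      have "entry (train N ?C) ks = entry A ks + entry B ks"
        unfolding entry_train[OF N C v] eA[OF v] eB[OF v']
        using v valid_index_map_upt by (intro chain_partial_direct_sum[OF factors]) blast
      thus "entry (A + B) ks = entry (train N ?C) ks"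
        using v by (simp add: plus_tensor_def entry_mk_tensor dA)
    qed
  }
  {
    assume eq: "dims A = dims B"
    let ?C = "\<lambda>n. partial_kron (physical_mode n) (Afac n) (Bfac n)"
    note C = train_factors_partial_kron[OF factors]
    show "A \<odot> B = train N ?C"
    proof (rule tensor_eqI)
      show "dims (A \<odot> B) = dims (train N ?C)"
        using dims_train[OF N C] dA by (simp add: hadamard_def)
      fix ks assume "valid_index (dims (A \<odot> B)) ks"
      hence v: "valid_index (map I [1..<N+1]) ks" by (simp add: hadamard_def dA)
      hence v': "valid_index (map J [1..<N+1]) ks" using eq dA dB by metis
      have "entry (train N ?C) ks = entry A ks * entry B ks"
        unfolding entry_train[OF N C v] eA[OF v] eB[OF v']
        using v valid_index_map_upt by (intro chain_partial_kron[OF factors]) blast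
      thus "entry (A \<odot> B) ks = entry (train N ?C) ks"
        using v by (simp add: hadamard_def entry_mk_tensor dA)
    qed
  }
  show "A \<oplus> B = train N (\<lambda>n. Afac n \<oplus> Bfac n)"
  proof (rule tensor_eqI)
    let ?C = "\<lambda>n. Afac n \<oplus> Bfac n"
    note C = train_factors_direct_sum[OF factors]
    have dS: "dims (A \<oplus> B) = map (\<lambda>n. I n + J n) [1..<N+1]"
      by (simp add: direct_sum_def dA dB map2_map_map del: upt_Suc)
    thus "dims (A \<oplus> B) = dims (train N ?C)"
      using dims_train[OF N C] by simp
    fix ks assume "valid_index (dims (A \<oplus> B)) ks"
    hence v: "valid_index (map (\<lambda>n. I n + J n) [1..<N+1]) ks" by (simp only: dS)
    hence len: "length ks = N"
      and bound: "\<And>n. 1 \<le> n \<Longrightarrow> n \<le> N \<Longrightarrow> ks ! (n - 1) < I n + J n"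
      by (simp_all only: valid_index_map_upt)
    let ?U = "\<lambda>n. slice N Afac n (ks ! (n - 1))"
    let ?V = "\<lambda>n r c. if I n \<le> ks ! (n - 1) then slice N Bfac n (ks ! (n - 1) - I n) r c else 0"
    let ?ls = "map2 (-) ks (map I [1..<N+1])"
    have ls: "?ls ! (n - 1) = ks ! (n - 1) - I n" if "1 \<le> n" "n \<le> N" for n
      unfolding map2_map_upt[OF len] using that by (rule nth_map_upt_1)
    have train: "entry (train N ?C) ks = chain R ?U (N - 1) 0 + chain S ?V (N - 1) 0"
      unfolding entry_train[OF N C v] using bound by (intro chain_direct_sum[OF factors])
    have sum: "entry (A \<oplus> B) ks = (if valid_index (map I [1..<N+1]) ks then entry A ks
        else if list_all2 (\<ge>) ks (map I [1..<N+1]) then entry B ?ls else 0)"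
      using v dS by (simp add: direct_sum_def entry_mk_tensor dA dB valid_index_def del: upt_Suc)
    have ge: "list_all2 (\<ge>) ks (map I [1..<N+1]) \<longleftrightarrow>
        (\<forall>n. 1 \<le> n \<longrightarrow> n \<le> N \<longrightarrow> I n \<le> ks ! (n - 1))"
    proof -
      have "(\<forall>m<N. I (Suc m) \<le> ks ! m) \<longleftrightarrow> (\<forall>n. 1 \<le> n \<longrightarrow> n \<le> N \<longrightarrow> I n \<le> ks ! (n - 1))"
        by (metis One_nat_def Suc_le_eq Suc_pred diff_Suc_1 le_simps(3) less_imp_le_nat zero_less_Suc)
      thus ?thesis using len by (simp add: list_all2_conv_all_nth del: upt_Suc)
    qed
    \<comment> \<open>If some index leaves the range of \<open>A\<close>, the slice of that factor
      is zero and annihilates the product.\<close>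
    have U: "chain R ?U (N - 1) 0 = (if valid_index (map I [1..<N+1]) ks then entry A ks else 0)"
    proof (cases "valid_index (map I [1..<N+1]) ks")
      case False
      then obtain n where n: "1 \<le> n" "n \<le> N" "I n \<le> ks ! (n - 1)"
        using len by (metis valid_index_map_upt not_less)
      with False show ?thesis
        using chain_eq_0[of n "N - 1" ?U R 0] slice_eq_0[OF Af n] by simp
    qed (use eA in simp)
    \<comment> \<open>If every index lies beyond the range of \<open>A\<close>, the shifted
      multi-index is valid for \<open>B\<close>. A single index within that range triggers the guard
      in \<open>?V\<close>, which zeroes a factor.\<close>
    have V: "chain S ?V (N - 1) 0 =
        (if list_all2 (\<ge>) ks (map I [1..<N+1]) then entry B ?ls else 0)"
    proof (cases "list_all2 (\<ge>) ks (map I [1..<N+1])")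
      case True
      have I_le: "I n \<le> ks ! (n - 1)" if "1 \<le> n" "n \<le> N" for n
        using True ge that by blast
      have "valid_index (map J [1..<N+1]) ?ls"
        unfolding valid_index_map_upt
      proof (intro conjI allI impI)
        fix n assume n: "1 \<le> n" "n \<le> N"
        show "?ls ! (n - 1) < J n"
          unfolding ls[OF n] using I_le[OF n] bound[OF n] by linarith
      qed (use len in simp)
      from eB[OF this] have "entry B ?ls = chain S (\<lambda>n. slice N Bfac n (?ls ! (n - 1))) (N - 1) 0" .
      also have "\<dots> = chain S ?V (N - 1) 0"
      proof (rule chain_cong)
        fix n r c assume "1 \<le> n" "n \<le> Suc (N - 1)"
        hence n: "1 \<le> n" "n \<le> N" using N by auto
        show "slice N Bfac n (?ls ! (n - 1)) r c = ?V n r c"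
          unfolding ls[OF n] using I_le[OF n] by simp
      qed
      finally show ?thesis using True by simp
    next
      case False
      then obtain n where "1 \<le> n" "n \<le> N" "\<not> I n \<le> ks ! (n - 1)"
        using ge by blast
      with False show ?thesis
        using chain_eq_0[of n "N - 1" ?V S 0] by simp
    qed
    \<comment> \<open>For an empty multi-index both conditions would hold; \<open>N \<ge> 2\<close>
      provides a mode in which they contradict each other. Hence at most one chain survives and the
      sum matches the case distinction.\<close>
    have "\<not> (valid_index (map I [1..<N+1]) ks \<and> list_all2 (\<ge>) ks (map I [1..<N+1]))"
      unfolding ge valid_index_map_upt using N by (metis le_trans not_less one_le_numeral order_refl)
    thus "entry (A \<oplus> B) ks = entry (train N ?C) ks"
      unfolding train sum U V by auto
  qed
  show "A \<otimes> B = train N (\<lambda>n. Afac n \<otimes> Bfac n)"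
  proof (rule tensor_eqI)
    let ?C = "\<lambda>n. Afac n \<otimes> Bfac n"
    note C = train_factors_kron[OF factors]
    have dK: "dims (A \<otimes> B) = map (\<lambda>n. I n * J n) [1..<N+1]"
      by (simp add: kron_def dA dB map2_map_map del: upt_Suc)
    thus "dims (A \<otimes> B) = dims (train N ?C)"
      using dims_train[OF N C] by simp
    fix ks assume "valid_index (dims (A \<otimes> B)) ks"
    hence v: "valid_index (map (\<lambda>n. I n * J n) [1..<N+1]) ks" by (simp only: dK)
    hence len: "length ks = N"
      and bound: "\<And>n. 1 \<le> n \<Longrightarrow> n \<le> N \<Longrightarrow> ks ! (n - 1) < I n * J n"
      by (simp_all only: valid_index_map_upt)
    let ?is = "map2 (div) ks (map J [1..<N+1])" and ?js = "map2 (mod) ks (map J [1..<N+1])"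
    have is_nth: "?is ! (n - 1) = ks ! (n - 1) div J n"
      and js_nth: "?js ! (n - 1) = ks ! (n - 1) mod J n" if "1 \<le> n" "n \<le> N" for n
      unfolding map2_map_upt[OF len] using that by (rule nth_map_upt_1)+
    have vi: "valid_index (map I [1..<N+1]) ?is"
      unfolding valid_index_map_upt
    proof (intro conjI allI impI)
      fix n assume n: "1 \<le> n" "n \<le> N"
      show "?is ! (n - 1) < I n"
        unfolding is_nth[OF n] using bound[OF n] by (simp add: less_mult_imp_div_less)
    qed (use len in simp)
    have vj: "valid_index (map J [1..<N+1]) ?js"
      unfolding valid_index_map_upt
    proof (intro conjI allI impI)
      fix n assume n: "1 \<le> n" "n \<le> N"
      show "?js ! (n - 1) < J n"
        \<comment> \<open>A remainder modulo 0 would not be bounded, but \<open>J n = 0\<close>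
          contradicts \<open>bound\<close>.\<close>
        unfolding js_nth[OF n] using bound[OF n] by (cases "J n = 0") simp_all
    qed (use len in simp)
    have "entry (train N ?C) ks =
        chain R (\<lambda>n. slice N Afac n (ks ! (n - 1) div J n)) (N - 1) 0 *
        chain S (\<lambda>n. slice N Bfac n (ks ! (n - 1) mod J n)) (N - 1) 0"
      unfolding entry_train[OF N C v] using bound by (intro chain_kron_slices[OF factors])
    also have "chain R (\<lambda>n. slice N Afac n (ks ! (n - 1) div J n)) (N - 1) 0 = entry A ?is"
      unfolding eA[OF vi] using N by (intro chain_cong) (simp only: is_nth)
    also have "chain S (\<lambda>n. slice N Bfac n (ks ! (n - 1) mod J n)) (N - 1) 0 = entry B ?js"
      unfolding eB[OF vj] using N by (intro chain_cong) (simp only: js_nth)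
    finally show "entry (A \<otimes> B) ks = entry (train N ?C) ks"
      using v dK by (simp add: kron_def entry_mk_tensor dA dB del: upt_Suc)
  qed
qed

end
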